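(* Let $r$ be a positive integer and $y_0=\Phi^t_{r-1}$. For $-1\le j\le r-1$, $$\Phi^t_{j}(z) = \frac{1}{x_{r+2}} \sum_{i=0}^{r-1-j} A^{(j)}_{i} z^i \mathcal{D}_q^i y_0 + \delta_{j, -1},$$ where, for $0\le i\le r-1-j$, $$A^{(j)}_i = \sum_{m=i}^{r-1-j} (x_{r+2-m} - x_1 x_{r+1-m}) S_q(m, i) + x_1 x_{j+2} S_q(r-1-j, i).$$
   Context: $q$ is a formal parameter, $[n]=(1-q^n)/(1-q)$. For an index $\mathbf k=(k_1,\dots,k_l)$ of positive integers, $Li_{\mathbf k;q}(z)=\sum_{m_1>\cdots>m_l\ge1}\frac{z^{m_1}}{[m_1]^{k_1}\cdots[m_l]^{k_l}}$, $Li^t_{\mathbf k;q}(z)=\sum_{\mathbf p}Li_{\mathbf p;q}(z)t^{l-\mathrm{dep}(\mathbf p)}$, $\mathbf p$ running over indices $(k_1\,\square\cdots\square\,k_l)$ with each $\square$ filled by ``$,$'' or ``$+$''. The $i$-height is $\#\{j:k_j\ge i+1\}$. For $k,l,h_1,\dots,h_r\ge0$ and $-1\le j\le r-1$, $I_j(k,l,h_1,\dots,h_r)$ is the set of indices of weight $k$, depth $l$, $i$-height $h_i$ with $k_1\ge j+2$; $G^t_j=\sum_{\mathbf k\in I_j}Li^t_{\mathbf k;q}(z)$ (empty sum $0$), $G^t=G^t_{-1}$, $G^t(0,\dots,0;z)=1$. For variables $x_1,\dots,x_{r+2}$, $\Phi^t_j(z)=\sum_{k,l,h_i\ge0}G^t_j(k,l,h_1,\dots,h_r;z)x_1^{k-l-\sum_i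 h_i}x_2^{l-h_1}x_3^{h_1-h_2}\cdots x_{r+1}^{h_{r-1}-h_r}x_{r+2}^{h_r}$. $(\mathcal D_q f)(z)=\frac{f(z)-f(qz)}{(1-q)z}$. The $q$-Stirling numbers: $S_q(0,0)=1$, $S_q(n,k)=q^{k-1}S_q(n-1,k-1)+[k]S_q(n-1,k)$ for $0<k\le n$, $0$ otherwise. *)

theory Defs
  imports
    "HOL-Computational_Algebra.Computational_Algebra"
    "HOL-Library.Multiset_Order"
    "HOL-Library.FuncSet"
begin

section \<open>Formal power series in the variables \<open>x\<^sub>0, x\<^sub>1, x\<^sub>2, \<dots>\<close>\<close>

text \<open>
  A multiset \<open>\<mu>\<close> of naturals stands for the monomial \<open>\<Prod>i\<in>#\<mu>. x\<^sub>i\<close>, and a power series is its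
  coefficient function. The number of variables has to depend on \<open>r\<close>, so the type
  provides countably many; a given statement only involves \<open>x\<^sub>1, \<dots>, x\<^bsub>r+2\<^esub>\<close>. The multiset
  extension of the order on the naturals is a monomial well-order, which shows that the ring
  is an integral domain.
\<close>

typedef 'a mvps = "UNIV :: (nat multiset \<Rightarrow> 'a) set"
  morphisms mvps_coeff Abs_mvps ..

setup_lifting type_definition_mvps

lemma mvps_eqI: "(\<And>\<mu>. mvps_coeff f \<mu> = mvps_coeff g \<mu>) \<Longrightarrow> f = g"
  by (simp add: mvps_coeff_inject[symmetric] fun_eq_iff)

lemma mvps_coeff_Abs [simp]: "mvps_coeff (Abs_mvps F) = F"
  by (simp add: Abs_mvps_inverse)

definition mset_splits :: "nat multiset \<Rightarrow> (nat multiset \<times> nat multiset) set" where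
  "mset_splits \<mu> = {(\<alpha>, \<beta>). \<alpha> + \<beta> = \<mu>}"

lemma finite_submsets: "finite {\<alpha>. \<alpha> \<subseteq># (\<mu> :: nat multiset)}"
proof (induction \<mu>)
  case (add x \<mu>)
  have "{\<alpha>. \<alpha> \<subseteq># add_mset x \<mu>} \<subseteq> {\<alpha>. \<alpha> \<subseteq># \<mu>} \<union> add_mset x ` {\<alpha>. \<alpha> \<subseteq># \<mu>}"
  proof
    fix \<alpha> assume "\<alpha> \<in> {\<alpha>. \<alpha> \<subseteq># add_mset x \<mu>}"
    then have a: "\<alpha> \<subseteq># add_mset x \<mu>" by simp
    show "\<alpha> \<in> {\<alpha>. \<alpha> \<subseteq># \<mu>} \<union> add_mset x ` {\<alpha>. \<alpha> \<subseteq># \<mu>}"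
    proof (cases "x \<in># \<alpha>")
      case True
      then obtain \<beta> where "\<alpha> = add_mset x \<beta>" by (metis mset_add)
      with a show ?thesis by auto
    next
      case False
      then have "count \<alpha> y \<le> count \<mu> y" for y
        using mset_subset_eq_count[OF a, of y] by (cases "y = x") (auto simp: not_in_iff)
      then show ?thesis by (simp add: subseteq_mset_def)
    qed
  qed
  with add show ?case by (meson finite_UnI finite_imageI finite_subset)
qed auto

lemma finite_mset_splits [simp]: "finite (mset_splits \<mu>)"
proof (rule finite_subset)
  show "mset_splits \<mu> \<subseteq> {\<alpha>. \<alpha> \<subseteq># \<mu>} \<times> {\<alpha>. \<alpha> \<subseteq># \<mu>}"
    by (auto simp: mset_splits_def)
qed (simp add: finite_submsets)

instantiation mvps :: (comm_ring_1) comm_ring_1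
begin

lift_definition zero_mvps :: "'a mvps" is "\<lambda>_. 0" .
lift_definition one_mvps :: "'a mvps" is "\<lambda>\<mu>. if \<mu> = {#} then 1 else 0" .
lift_definition plus_mvps :: "'a mvps \<Rightarrow> 'a mvps \<Rightarrow> 'a mvps" is "\<lambda>f g \<mu>. f \<mu> + g \<mu>" .
lift_definition minus_mvps :: "'a mvps \<Rightarrow> 'a mvps \<Rightarrow> 'a mvps" is "\<lambda>f g \<mu>. f \<mu> - g \<mu>" .
lift_definition uminus_mvps :: "'a mvps \<Rightarrow> 'a mvps" is "\<lambda>f \<mu>. - f \<mu>" .
lift_definition times_mvps :: "'a mvps \<Rightarrow> 'a mvps \<Rightarrow> 'a mvps" is
  "\<lambda>f g \<mu>. \<Sum>(\<alpha>, \<beta>)\<in>mset_splits \<mu>. f \<alpha> * g \<beta>" .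

instance
proof
  fix a b c :: "'a mvps"
  show "a * b * c = a * (b * c)"
  proof (transfer, rule ext)
    fix f g h :: "nat multiset \<Rightarrow> 'a" and \<mu>
    have "(\<Sum>(\<alpha>, \<beta>)\<in>mset_splits \<mu>. (\<Sum>(\<alpha>, \<beta>)\<in>mset_splits \<alpha>. f \<alpha> * g \<beta>) * h \<beta>) =
      (\<Sum>(p, s)\<in>(SIGMA p:mset_splits \<mu>. mset_splits (fst p)). f (fst s) * g (snd s) * h (snd p))"
      by (subst sum.Sigma[symmetric]) (auto simp: case_prod_unfold sum_distrib_right)
    also have "\<dots> =
      (\<Sum>(p, s)\<in>(SIGMA p:mset_splits \<mu>. mset_splits (snd p)). f (fst p) * (g (fst s) * h (snd s)))"
      by (rule sum.reindex_bij_witness[of _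
            "\<lambda>(p, s). ((fst p + fst s, snd s), (fst p, fst s))"
            "\<lambda>(p, s). ((fst s, snd s + snd p), (snd s, snd p))"])
         (auto simp: mset_splits_def add_ac mult_ac)
    also have "\<dots> = (\<Sum>(\<alpha>, \<beta>)\<in>mset_splits \<mu>. f \<alpha> * (\<Sum>(\<alpha>, \<beta>)\<in>mset_splits \<beta>. g \<alpha> * h \<beta>))"
      by (subst sum.Sigma[symmetric]) (auto simp: case_prod_unfold sum_distrib_left)
    finally show "(\<Sum>(\<alpha>, \<beta>)\<in>mset_splits \<mu>. (\<Sum>(\<alpha>, \<beta>)\<in>mset_splits \<alpha>. f \<alpha> * g \<beta>) * h \<beta>) =
      (\<Sum>(\<alpha>, \<beta>)\<in>mset_splits \<mu>. f \<alpha> * (\<Sum>(\<alpha>, \<beta>)\<in>mset_splits \<beta>. g \<alpha> * h \<beta>))" .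
  qed
  show "a * b = b * a"
  proof (transfer, rule ext)
    fix f g :: "nat multiset \<Rightarrow> 'a" and \<mu>
    show "(\<Sum>(\<alpha>, \<beta>)\<in>mset_splits \<mu>. f \<alpha> * g \<beta>) = (\<Sum>(\<alpha>, \<beta>)\<in>mset_splits \<mu>. g \<alpha> * f \<beta>)"
      by (rule sum.reindex_bij_witness[of _ prod.swap prod.swap])
         (auto simp: mset_splits_def add_ac mult_ac)
  qed
  show "1 * a = a"
  proof (transfer, rule ext)
    fix f :: "nat multiset \<Rightarrow> 'a" and \<mu>
    have "(\<Sum>(\<alpha>, \<beta>)\<in>mset_splits \<mu>. (if \<alpha> = {#} then 1 else 0) * f \<beta>) =
          (\<Sum>(\<alpha>, \<beta>)\<in>{({#} :: nat multiset, \<mu>)}. (if \<alpha> = {#} then 1 else 0) * f \<beta>)"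
      by (rule sum.mono_neutral_right, rule finite_mset_splits)
         (auto simp: mset_splits_def split: if_splits)
    then show "(\<Sum>(\<alpha>, \<beta>)\<in>mset_splits \<mu>. (if \<alpha> = {#} then 1 else 0) * f \<beta>) = f \<mu>" by simp
  qed
  show "(a + b) * c = a * c + b * c"
    by transfer (simp add: fun_eq_iff case_prod_unfold sum.distrib distrib_right)
  show "(0 :: 'a mvps) \<noteq> 1"
    by transfer (auto simp: fun_eq_iff)
qed (transfer; simp add: fun_eq_iff add_ac)+

end

instance mvps :: (idom) idom
proof
  fix a b :: "'a mvps"
  assume "a \<noteq> 0" "b \<noteq> 0"
  define f g where "f = mvps_coeff a" and "g = mvps_coeff b"
  have "\<exists>\<alpha>. f \<alpha> \<noteq> 0" "\<exists>\<beta>. g \<beta> \<noteq> 0"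
    using \<open>a \<noteq> 0\<close> \<open>b \<noteq> 0\<close> unfolding f_def g_def by (transfer; auto simp: fun_eq_iff)+
  then obtain \<alpha>0 \<beta>0 where
    \<alpha>0: "f \<alpha>0 \<noteq> 0" "\<And>\<alpha>. f \<alpha> \<noteq> 0 \<Longrightarrow> \<alpha>0 \<le> \<alpha>" and
    \<beta>0: "g \<beta>0 \<noteq> 0" "\<And>\<beta>. g \<beta> \<noteq> 0 \<Longrightarrow> \<beta>0 \<le> \<beta>"
    using LeastI_ex[of "\<lambda>\<alpha>. f \<alpha> \<noteq> 0"] Least_le[of "\<lambda>\<alpha>. f \<alpha> \<noteq> 0"]
      LeastI_ex[of "\<lambda>\<beta>. g \<beta> \<noteq> 0"] Least_le[of "\<lambda>\<beta>. g \<beta> \<noteq> 0"] by blast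
  have "(\<Sum>(\<alpha>, \<beta>)\<in>mset_splits (\<alpha>0 + \<beta>0). f \<alpha> * g \<beta>) = (\<Sum>(\<alpha>, \<beta>)\<in>{(\<alpha>0, \<beta>0)}. f \<alpha> * g \<beta>)"
  proof (rule sum.mono_neutral_right)
    show "\<forall>p\<in>mset_splits (\<alpha>0 + \<beta>0) - {(\<alpha>0, \<beta>0)}. (case p of (\<alpha>, \<beta>) \<Rightarrow> f \<alpha> * g \<beta>) = 0"
    proof
      fix p assume p: "p \<in> mset_splits (\<alpha>0 + \<beta>0) - {(\<alpha>0, \<beta>0)}"
      obtain \<alpha> \<beta> where [simp]: "p = (\<alpha>, \<beta>)" by (cases p)
      have eq: "\<alpha> + \<beta> = \<alpha>0 + \<beta>0" and ne: "\<alpha> \<noteq> \<alpha>0"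
        using p by (auto simp: mset_splits_def)
      have "f \<alpha> = 0 \<or> g \<beta> = 0"
      proof (rule ccontr)
        assume "\<not> (f \<alpha> = 0 \<or> g \<beta> = 0)"
        then have "\<alpha>0 < \<alpha>" "\<beta>0 \<le> \<beta>"
          using \<alpha>0(2)[of \<alpha>] \<beta>0(2)[of \<beta>] ne by (simp_all add: order_less_le)
        then have "\<alpha>0 + \<beta>0 < \<alpha> + \<beta>" by (rule add_less_le_mono)
        with eq show False by simp
      qed
      then show "(case p of (\<alpha>, \<beta>) \<Rightarrow> f \<alpha> * g \<beta>) = 0" by auto
    qed
  qed (rule finite_mset_splits, simp add: mset_splits_def)
  also have "\<dots> \<noteq> 0" using \<alpha>0 \<beta>0 by simp
  finally have "mvps_coeff (a * b) (\<alpha>0 + \<beta>0) \<noteq> 0"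
    unfolding f_def g_def by (simp add: times_mvps.rep_eq)
  then show "a * b \<noteq> 0" by (auto simp: zero_mvps.rep_eq)
qed

definition mvps_const :: "'a::comm_ring_1 \<Rightarrow> 'a mvps" where
  "mvps_const c = Abs_mvps (\<lambda>\<mu>. if \<mu> = {#} then c else 0)"

definition mvps_var :: "nat \<Rightarrow> 'a::comm_ring_1 mvps" where
  "mvps_var i = Abs_mvps (\<lambda>\<mu>. if \<mu> = {#i#} then 1 else 0)"

text \<open>
  The formal sum of a family of power series in which every monomial occurs in only finitely
  many members.
\<close>

definition mvps_sum :: "('i \<Rightarrow> 'a::comm_ring_1 mvps) \<Rightarrow> 'i set \<Rightarrow> 'a mvps" where
  "mvps_sum f I = Abs_mvps (\<lambda>\<mu>. \<Sum>i\<in>{i\<in>I. mvps_coeff (f i) \<mu> \<noteq> 0}. mvps_coeff (f i) \<mu>)"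


section \<open>Interpolated \<open>q\<close>-polylogarithms\<close>

definition qnum :: "'a::field \<Rightarrow> nat \<Rightarrow> 'a" where
  "qnum q n = (1 - q ^ n) / (1 - q)"

text \<open>
  An index \<open>(k\<^sub>1, \<dots>, k\<^sub>l)\<close> is a nonempty list of positive integers. The coefficient of \<open>z\<^sup>n\<close> in the
  \<open>q\<close>-polylogarithm collects the finitely many tuples with \<open>m\<^sub>1 = n\<close>.
\<close>

definition qLi :: "'a::field \<Rightarrow> nat list \<Rightarrow> 'a fps" where
  "qLi q ks = Abs_fps (\<lambda>n.
     \<Sum>ms | length ms = length ks \<and> ms \<noteq> [] \<and> hd ms = n \<and> sorted_wrt (>) ms \<and> (\<forall>m\<in>set ms. m \<ge> 1).
       1 / (\<Prod>i<length ks. qnum q (ms ! i) ^ (ks ! i)))"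

text \<open>All \<open>2\<^bsup>l-1\<^esup>\<close> ways to fill the boxes of \<open>(k\<^sub>1 \<box> \<cdots> \<box> k\<^sub>l)\<close> with a comma or a plus sign.\<close>

fun fillings :: "nat list \<Rightarrow> nat list list" where
  "fillings [] = []"
| "fillings [k] = [[k]]"
| "fillings (k # k' # ks) = map ((#) k) (fillings (k' # ks)) @ fillings ((k + k') # ks)"

definition qLi_t :: "'a::field \<Rightarrow> 'a \<Rightarrow> nat list \<Rightarrow> 'a fps" where
  "qLi_t q t ks = (\<Sum>p\<leftarrow>fillings ks. qLi q p * fps_const (t ^ (length ks - length p)))"


section \<open>Sums of fixed weight, depth and heights\<close>

definition height :: "nat \<Rightarrow> nat list \<Rightarrow> nat" where
  "height i ks = card {j. j < length ks \<and> ks ! j \<ge> i + 1}"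

text \<open>The heights \<open>h\<^sub>1, \<dots>, h\<^sub>r\<close> are given by a function on \<open>{1..r}\<close>.\<close>

definition I_set :: "nat \<Rightarrow> int \<Rightarrow> nat \<Rightarrow> nat \<Rightarrow> (nat \<Rightarrow> nat) \<Rightarrow> nat list set" where
  "I_set r j k l h =
     {ks. ks \<noteq> [] \<and> (\<forall>a\<in>set ks. a \<ge> 1) \<and> sum_list ks = k \<and> length ks = l \<and>
          (\<forall>i\<in>{1..r}. height i ks = h i) \<and> int (hd ks) \<ge> j + 2}"

definition G_sum :: "'a::field \<Rightarrow> 'a \<Rightarrow> nat \<Rightarrow> int \<Rightarrow> nat \<Rightarrow> nat \<Rightarrow> (nat \<Rightarrow> nat) \<Rightarrow> 'a fps" where
  "G_sum q t r j k l h =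
     (if j = -1 \<and> k = 0 \<and> l = 0 \<and> (\<forall>i\<in>{1..r}. h i = 0) then 1
      else \<Sum>ks\<in>I_set r j k l h. qLi_t q t ks)"


section \<open>Generating functions\<close>

text \<open>
  The subtractions below are truncated, but whenever one of the differences would be negative
  the set \<open>I_set r j k l h\<close> is empty and the factor \<open>G_sum q t r j k l h\<close> vanishes:
  the weight minus the depth is at least the sum of the heights, and the heights decrease.
\<close>

definition x_monom :: "nat \<Rightarrow> nat \<Rightarrow> nat \<Rightarrow> (nat \<Rightarrow> nat) \<Rightarrow> 'a::comm_ring_1 mvps" where
  "x_monom r k l h =
     mvps_var 1 ^ (k - l - (\<Sum>i=1..r. h i)) * mvps_var 2 ^ (l - h 1) *
     (\<Prod>i\<in>{1..<r}. mvps_var (i + 2) ^ (h i - h (i + 1))) * mvps_var (r + 2) ^ h r"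

text \<open>
  A series in \<open>z\<close> whose coefficients are power series in \<open>x\<^sub>1, \<dots>, x\<^bsub>r+2\<^esub>\<close>; these are put into
  the field of fractions, where \<open>x\<^bsub>r+2\<^esub>\<close> is invertible. The infinite sum is formed in the
  coefficient of each power of \<open>z\<close>.
\<close>

definition Phi :: "'a::field \<Rightarrow> 'a \<Rightarrow> nat \<Rightarrow> int \<Rightarrow> 'a mvps fract fps" where
  "Phi q t r j = Abs_fps (\<lambda>n. to_fract (
     mvps_sum (\<lambda>(k, l, h). mvps_const (fps_nth (G_sum q t r j k l h) n) * x_monom r k l h)
       (UNIV \<times> UNIV \<times> ({1..r} \<rightarrow>\<^sub>E UNIV))))"

abbreviation x_var :: "nat \<Rightarrow> 'a::field mvps fract" where
  "x_var i \<equiv> to_fract (mvps_var i)"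

abbreviation scalar :: "'a::field \<Rightarrow> 'a mvps fract" where
  "scalar c \<equiv> to_fract (mvps_const c)"


section \<open>The \<open>q\<close>-difference operator and \<open>q\<close>-Stirling numbers\<close>

definition Dq :: "'a::field \<Rightarrow> 'a fps \<Rightarrow> 'a fps" where
  "Dq q f = (f - fps_compose f (fps_const q * fps_X)) / (fps_const (1 - q) * fps_X)"

fun Sq :: "'a::field \<Rightarrow> nat \<Rightarrow> nat \<Rightarrow> 'a" where
  "Sq q 0 0 = 1"
| "Sq q (Suc n) (Suc k) =
     (if k \<le> n then q ^ k * Sq q n k + qnum q (Suc k) * Sq q n (Suc k) else 0)"
| "Sq q 0 (Suc k) = 0"
| "Sq q (Suc n) 0 = 0"

definition A_coeff :: "'a::field \<Rightarrow> nat \<Rightarrow> int \<Rightarrow> nat \<Rightarrow> 'a mvps fract" where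
  "A_coeff q r j i =
     (let d = nat (int r - 1 - j) in
      (\<Sum>m=i..d. (x_var (r + 2 - m) - x_var 1 * x_var (r + 1 - m)) * Sq (scalar q) m i) +
      x_var 1 * x_var (nat (j + 2)) * Sq (scalar q) d i)"


section \<open>Formal parameters\<close>

text \<open>The indeterminates \<open>q\<close> and \<open>t\<close> of the field of rational functions \<open>\<rat>(q, t)\<close>.\<close>

definition q_par :: "rat poly poly fract" where
  "q_par = to_fract [:[:0, 1:]:]"

definition t_par :: "rat poly poly fract" where
  "t_par = to_fract [:0, 1:]"

end

theory Submission
  imports Defs
begin

text \<open>
  On the coefficient of \<open>z\<^sup>n\<close> the operator \<open>z D\<^sub>q\<close> is multiplication by \<open>N = [n]\<close>, and
  \<open>N\<^sup>m\<close> is the combination of the factors \<open>[n][n-1]\<cdots>[n-i+1]\<close> of \<open>z\<^sup>i D\<^sub>q\<^sup>i\<close> with weights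
  \<open>S\<^sub>q(m, i)\<close>. Hence it suffices to express the \<open>n\<close>-th coefficient \<open>F\<^sub>j\<close> of \<open>\<Phi>\<^sub>j\<close> (without the
  constant 1) by \<open>F\<^bsub>r-1\<^esub>\<close> and powers of \<open>N\<close>. Adding \<open>a\<close> to the first entry of an index divides
  the \<open>n\<close>-th coefficient of its interpolated polylogarithm by \<open>N\<^sup>a\<close>, because the first entry
  always belongs to the summation variable \<open>m\<^sub>1 = n\<close>, whether it is merged with its neighbour or
  not. A first entry \<open>a\<close> contributes the monomial \<open>x\<^bsub>a+1\<^esub>\<close> for \<open>a \<le> r + 1\<close> and
  \<open>x\<^sub>1\<^bsup>a-r-1\<^esup> x\<^bsub>r+2\<^esub>\<close> beyond, so with a common factor \<open>T\<close> for the remaining entries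
  \<open>(N - x\<^sub>1) F\<^bsub>r-1\<^esub> = x\<^bsub>r+2\<^esub> N\<^bsup>-r\<^esup> T\<close> and \<open>F\<^sub>j = F\<^bsub>r-1\<^esub> + (\<Sum>a=j+2..r. x\<^bsub>a+1\<^esub> N\<^bsup>-a\<^esup> T)\<close>;
  eliminating \<open>T\<close> gives the claim.
\<close>

section \<open>Monomials\<close>

definition mvps_monom :: "nat multiset \<Rightarrow> 'a::comm_ring_1 mvps" where
  "mvps_monom \<alpha> = Abs_mvps (\<lambda>\<mu>. if \<mu> = \<alpha> then 1 else 0)"

lemma mvps_coeff_monom_mult:
  "mvps_coeff (mvps_monom \<alpha> * f) \<mu> = (if \<alpha> \<subseteq># \<mu> then mvps_coeff f (\<mu> - \<alpha>) else 0)"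
proof -
  have "mvps_coeff (mvps_monom \<alpha> * f) \<mu> =
      (\<Sum>(\<gamma>, \<beta>)\<in>mset_splits \<mu>. (if \<gamma> = \<alpha> then 1 else 0) * mvps_coeff f \<beta>)"
    by (simp add: times_mvps.rep_eq mvps_monom_def)
  also have "\<dots> = (\<Sum>p\<in>(if \<alpha> \<subseteq># \<mu> then {(\<alpha>, \<mu> - \<alpha>)} else {}). mvps_coeff f (snd p))"
    by (rule sum.mono_neutral_cong_right[OF finite_mset_splits])
      (auto simp: mset_splits_def split: if_splits)
  finally show ?thesis by simp
qed

lemma mvps_monom_mult: "mvps_monom \<alpha> * mvps_monom \<beta> = mvps_monom (\<alpha> + \<beta>)"
  by (rule mvps_eqI) (auto simp: mvps_coeff_monom_mult, auto simp: mvps_monom_def)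

lemma mvps_var_conv_monom: "mvps_var i = mvps_monom {#i#}"
  by (simp add: mvps_var_def mvps_monom_def)

lemma mvps_one_conv_monom: "1 = mvps_monom {#}"
  by (rule mvps_eqI) (simp add: one_mvps.rep_eq mvps_monom_def)

lemma mvps_var_power: "mvps_var i ^ n = mvps_monom (replicate_mset n i)"
  by (induction n) (simp_all add: mvps_one_conv_monom mvps_var_conv_monom mvps_monom_mult)

lemma mvps_prod_monom: "(\<Prod>i\<in>A. mvps_monom (f i)) = mvps_monom (\<Sum>i\<in>A. f i)"
  by (induction A rule: infinite_finite_induct) (simp_all add: mvps_one_conv_monom mvps_monom_mult)

lemma mvps_coeff_const_mult [simp]: "mvps_coeff (mvps_const c * f) \<mu> = c * mvps_coeff f \<mu>"
proof -
  have "mvps_coeff (mvps_const c * f) \<mu> =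
      (\<Sum>(\<gamma>, \<beta>)\<in>mset_splits \<mu>. (if \<gamma> = {#} then c else 0) * mvps_coeff f \<beta>)"
    by (simp add: times_mvps.rep_eq mvps_const_def)
  also have "\<dots> = (\<Sum>p\<in>{({#} :: nat multiset, \<mu>)}. c * mvps_coeff f (snd p))"
    by (rule sum.mono_neutral_cong_right[OF finite_mset_splits])
      (auto simp: mset_splits_def split: if_splits)
  finally show ?thesis by simp
qed

lemma mvps_const_0 [simp]: "mvps_const 0 = 0"
  by (rule mvps_eqI) (simp add: mvps_const_def zero_mvps.rep_eq)

lemma mvps_const_1 [simp]: "mvps_const 1 = 1"
  by (rule mvps_eqI) (simp add: mvps_const_def one_mvps.rep_eq)

lemma mvps_const_diff: "mvps_const (a - b) = mvps_const a - mvps_const b"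
  by (rule mvps_eqI) (simp add: mvps_const_def minus_mvps.rep_eq)

lemma mvps_const_mult: "mvps_const (a * b) = mvps_const a * mvps_const b"
  by (rule mvps_eqI) (simp, simp add: mvps_const_def)

lemma mvps_const_power: "mvps_const (a ^ n) = mvps_const a ^ n"
  by (induction n) (simp_all add: mvps_const_mult)

lemma mvps_const_eq_0_iff [simp]: "mvps_const a = 0 \<longleftrightarrow> a = 0"
proof
  assume "mvps_const a = 0"
  then have "mvps_coeff (mvps_const a) {#} = mvps_coeff 0 {#}" by simp
  then show "a = 0" by (simp add: mvps_const_def zero_mvps.rep_eq)
qed simp

lemma mvps_var_neq_0 [simp]: "mvps_var i \<noteq> (0 :: 'a::comm_ring_1 mvps)"
proof
  assume "mvps_var i = (0 :: 'a mvps)"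
  then have "mvps_coeff (mvps_var i :: 'a mvps) {#i#} = mvps_coeff 0 {#i#}" by simp
  then show False by (simp add: mvps_var_def zero_mvps.rep_eq)
qed


section \<open>The \<open>q\<close>-difference operator on coefficients\<close>

lemma Dq_nth:
  fixes q :: "'a::field"
  assumes "q \<noteq> 1"
  shows "fps_nth (Dq q f) n = qnum q (Suc n) * fps_nth f (Suc n)"
proof -
  have "f - fps_compose f (fps_const q * fps_X) = (Abs_fps (\<lambda>n. (1 - q ^ n) * fps_nth f n))"
    by (rule fps_ext) (simp add: left_diff_distrib)
  \<comment> \<open>The numerator of \<open>Dq\<close> has constant term 0, so it is an exact
    multiple of the divisor, which can then be cancelled.\<close>
  also have "\<dots> = Abs_fps (\<lambda>n. qnum q (Suc n) * fps_nth f (Suc n)) * (fps_const (1 - q) * fps_X)"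
    (is "_ = ?g * _")
  proof (rule fps_ext)
    show "fps_nth (Abs_fps (\<lambda>n. (1 - q ^ n) * fps_nth f n)) n = fps_nth (?g * (fps_const (1 - q) * fps_X)) n" for n
      using assms by (cases n) (simp_all add: qnum_def flip: mult.assoc)
  qed
  finally have "Dq q f = ?g * (fps_const (1 - q) * fps_X) / (fps_const (1 - q) * fps_X)"
    by (simp only: Dq_def)
  also have "\<dots> = ?g"
    using assms by (intro nonzero_mult_div_cancel_right) simp
  finally show ?thesis by simp
qed

text \<open>The \<open>q\<close>-falling factorial \<open>[n][n-1]...[n-i+1]\<close>. For
  \<open>i > n\<close> the factor at \<open>k = n\<close> is \<open>[0] = 0\<close>.\<close>

definition qnum_ffact :: "'a::field \<Rightarrow> nat \<Rightarrow> nat \<Rightarrow> 'a" where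
  "qnum_ffact q i n = (\<Prod>k<i. qnum q (n - k))"

lemma qnum_ffact_eq_0: "n < i \<Longrightarrow> qnum_ffact q i n = 0"
  by (auto simp: qnum_ffact_def qnum_def intro!: prod_zero bexI[of _ n])

lemma Dq_funpow_nth:
  fixes q :: "'a::field"
  assumes "q \<noteq> 1"
  shows "fps_nth ((Dq q ^^ i) f) n = qnum_ffact q i (n + i) * fps_nth f (n + i)"
proof (induction i arbitrary: n)
  case (Suc i)
  then show ?case
    by (simp add: Dq_nth assms qnum_ffact_def mult_ac)
qed (simp add: qnum_ffact_def)

text \<open>The power of \<open>fps_X\<close> undoes the index shift of \<open>Dq\<close>; below
  degree \<open>i\<close> the falling factorial vanishes.\<close>

lemma X_power_Dq_funpow_nth:
  fixes q :: "'a::field"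
  assumes "q \<noteq> 1"
  shows "fps_nth (fps_X ^ i * (Dq q ^^ i) f) n = qnum_ffact q i n * fps_nth f n"
  by (simp add: fps_X_power_mult_nth Dq_funpow_nth assms qnum_ffact_eq_0)

lemma qnum_add: "qnum q (a + b) = qnum q a + q ^ a * qnum q b"
  by (simp add: qnum_def power_add algebra_simps flip: add_divide_distrib)

text \<open>From \<open>[n] = [i] + q^i [n-i]\<close>, where \<open>[n-i]\<close> is the next factor
  of the falling factorial. This is dual to the recursion of \<open>Sq\<close>.\<close>

lemma qnum_mult_ffact:
  "qnum q n * qnum_ffact q i n = qnum q i * qnum_ffact q i n + q ^ i * qnum_ffact q (Suc i) n"
proof (cases "i \<le> n")
  case True
  then show ?thesis
    using qnum_add[of q i "n - i"] by (simp add: qnum_ffact_def algebra_simps)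
qed (simp add: qnum_ffact_eq_0)

lemma Sq_eq_0: "m < i \<Longrightarrow> Sq q m i = 0"
  by (induction q m i rule: Sq.induct) auto

text \<open>On the coefficient of \<open>z\<^sup>n\<close> this says that \<open>(z D\<^sub>q)\<^sup>m\<close> is the \<open>q\<close>-Stirling combination of
  the \<open>z\<^sup>i D\<^sub>q\<^sup>i\<close>.\<close>

lemma sum_Sq_qnum_ffact: "(\<Sum>i\<le>m. Sq q m i * qnum_ffact q i n) = qnum q n ^ m"
proof (induction m)
  case (Suc m)
  have "(\<Sum>i\<le>Suc m. Sq q (Suc m) i * qnum_ffact q i n) =
      (\<Sum>i\<le>m. (q ^ i * Sq q m i + qnum q (Suc i) * Sq q m (Suc i)) * qnum_ffact q (Suc i) n)"
    by (subst sum.atMost_Suc_shift) simp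
  also have "\<dots> = (\<Sum>i\<le>m. Sq q m i * (q ^ i * qnum_ffact q (Suc i) n)) +
      (\<Sum>i\<le>m. Sq q m (Suc i) * (qnum q (Suc i) * qnum_ffact q (Suc i) n))"
    by (simp add: algebra_simps sum.distrib)
  \<comment> \<open>The new term at \<open>i = 0\<close> carries \<open>[0] = 0\<close>; the one at
    \<open>i = Suc m\<close>, dropped next, carries \<open>Sq q m (Suc m) = 0\<close>.\<close>
  also have "(\<Sum>i\<le>m. Sq q m (Suc i) * (qnum q (Suc i) * qnum_ffact q (Suc i) n)) =
      (\<Sum>i\<le>Suc m. Sq q m i * (qnum q i * qnum_ffact q i n))"
    by (subst sum.atMost_Suc_shift) (simp add: qnum_def)
  also have "\<dots> = (\<Sum>i\<le>m. Sq q m i * (qnum q i * qnum_ffact q i n))"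
    by (simp add: Sq_eq_0)
  also have "(\<Sum>i\<le>m. Sq q m i * (q ^ i * qnum_ffact q (Suc i) n)) + \<dots> =
      (\<Sum>i\<le>m. Sq q m i * (qnum q n * qnum_ffact q i n))"
    by (simp add: qnum_mult_ffact algebra_simps sum.distrib)
  also have "\<dots> = qnum q n * qnum q n ^ m"
    by (simp add: Suc.IH[symmetric] sum_distrib_left mult_ac)
  finally show ?case by simp
qed (simp add: qnum_ffact_def)


section \<open>Separating the first entry of an index\<close>

text \<open>The first entry always lies in the first part of a filling, alone or merged, so an
  increase passes to the head of each filling.\<close>

lemma fillings_add_hd: "fillings ((a + b) # ks) = map (\<lambda>p. (a + hd p) # tl p) (fillings (b # ks))"
proof (induction ks arbitrary: a b)
  case (Cons k ks)
  have "fillings ((a + b + k) # ks) = map (\<lambda>p. (a + hd p) # tl p) (fillings ((b + k) # ks))"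
    using Cons.IH[of a "b + k"] by (simp add: add.assoc)
  then show ?case by (simp add: comp_def)
qed simp

lemma fillings_neq_Nil: "p \<in> set (fillings ks) \<Longrightarrow> p \<noteq> []"
  by (induction ks rule: fillings.induct) auto

lemma fps_nth_sum_list: "fps_nth (\<Sum>x\<leftarrow>xs. f x) n = (\<Sum>x\<leftarrow>xs. fps_nth (f x) n)"
  by (induction xs) auto

text \<open>Every tuple has first member \<open>n\<close>, so the first entry only governs a power
  of \<open>[n]\<close>. For \<open>n = 0\<close> there are no tuples.\<close>

lemma qLi_add_hd:
  fixes q :: "'a::field"
  assumes "n > 0 \<Longrightarrow> qnum q n \<noteq> 0"
  shows "qnum q n ^ a * fps_nth (qLi q ((a + b) # ks)) n = fps_nth (qLi q (b # ks)) n"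
proof -
  have "qnum q n ^ a * (1 / (\<Prod>i<Suc (length ks). qnum q (ms ! i) ^ (((a + b) # ks) ! i))) =
      1 / (\<Prod>i<Suc (length ks). qnum q (ms ! i) ^ ((b # ks) ! i))"
    if "ms \<noteq> []" "hd ms = n" "\<forall>m\<in>set ms. m \<ge> 1" for ms
  proof -
    have "n > 0" using that by (cases ms) auto
    then have N: "qnum q n \<noteq> 0" by (rule assms)
    have hd: "ms ! 0 = n" using that by (cases ms) auto
    have cancel: "x ^ a * (1 / (x ^ (a + b) * y)) = 1 / (x ^ b * y)" if "x \<noteq> 0" for x y :: 'a
      using that by (simp add: power_add)
    show ?thesis
      unfolding prod.lessThan_Suc_shift nth_Cons_0 nth_Cons_Suc hd by (rule cancel) (rule N)
  qed
  then show ?thesis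
    unfolding qLi_def fps_nth_Abs_fps sum_distrib_left
    by (intro sum.cong) (simp_all del: prod.lessThan_Suc)
qed

text \<open>Raising the head of a filling keeps its length, hence the power of
  \<open>t\<close>.\<close>

lemma qLi_t_add_hd:
  fixes q :: "'a::field"
  assumes "n > 0 \<Longrightarrow> qnum q n \<noteq> 0"
  shows "qnum q n ^ a * fps_nth (qLi_t q t ((a + b) # ks)) n = fps_nth (qLi_t q t (b # ks)) n"
proof -
  have "qnum q n ^ a * (fps_nth (qLi q ((a + hd p) # tl p)) n * t ^ (length ks - length (tl p))) =
      fps_nth (qLi q p) n * t ^ (Suc (length ks) - length p)" if p: "p \<in> set (fillings (b # ks))" for p
  proof -
    obtain c p' where "p = c # p'" using fillings_neq_Nil[OF p] by (cases p) auto
    then show ?thesis using qLi_add_hd[of n q a c p', OF assms] by (simp flip: mult.assoc)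
  qed
  then have "(\<Sum>p\<leftarrow>fillings (b # ks).
        qnum q n ^ a * (fps_nth (qLi q ((a + hd p) # tl p)) n * t ^ (length ks - length (tl p)))) =
      (\<Sum>p\<leftarrow>fillings (b # ks). fps_nth (qLi q p) n * t ^ (Suc (length ks) - length p))"
    by (intro arg_cong[where f = sum_list] map_cong refl)
  then show ?thesis
    by (simp add: qLi_t_def fillings_add_hd fps_nth_sum_list comp_def sum_list_const_mult)
qed

lemma qLi_t_nth_0 [simp]: "fps_nth (qLi_t q t ks) 0 = 0"
proof -
  have e: "{ms :: nat list. length ms = length p \<and> ms \<noteq> [] \<and> hd ms = 0 \<and> sorted_wrt (>) ms \<and> (\<forall>m\<in>set ms. m \<ge> 1)} = {}"
    for p :: "nat list"
  proof -
    have "0 < hd ms" if "ms \<noteq> []" "\<forall>m\<in>set ms. m \<ge> 1" for ms :: "nat list"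
      using that by (cases ms) auto
    then show ?thesis by force
  qed
  have "fps_nth (qLi q p) 0 = 0" for p
    by (simp only: qLi_def fps_nth_Abs_fps e) simp
  then show ?thesis by (simp add: qLi_t_def fps_nth_sum_list)
qed


section \<open>The monomial of an index\<close>

text \<open>The contribution of one entry to the exponents in \<open>x_monom\<close>, which are
  additive over the entries of an index.\<close>

definition entry_mset :: "nat \<Rightarrow> nat \<Rightarrow> nat multiset" where
  "entry_mset r a = add_mset (min (a + 1) (r + 2)) (replicate_mset (a - (r + 1)) 1)"

definition index_mset :: "nat \<Rightarrow> nat list \<Rightarrow> nat multiset" where
  "index_mset r ks = (\<Sum>a\<leftarrow>ks. entry_mset r a)"

definition heights_mset :: "nat \<Rightarrow> nat \<Rightarrow> nat \<Rightarrow> (nat \<Rightarrow> nat) \<Rightarrow> nat multiset" where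
  "heights_mset r k l h =
     replicate_mset (k - l - (\<Sum>i=1..r. h i)) 1 + replicate_mset (l - h 1) 2 +
     (\<Sum>i\<in>{1..<r}. replicate_mset (h i - h (i + 1)) (i + 2)) + replicate_mset (h r) (r + 2)"

lemma x_monom_eq: "x_monom r k l h = mvps_monom (heights_mset r k l h)"
  by (simp add: x_monom_def heights_mset_def mvps_var_power mvps_prod_monom mvps_monom_mult)

lemma index_mset_Nil [simp]: "index_mset r [] = {#}"
  by (simp add: index_mset_def)

lemma index_mset_Cons [simp]: "index_mset r (a # ks) = entry_mset r a + index_mset r ks"
  by (simp add: index_mset_def)

lemma height_Nil [simp]: "height i [] = 0"
  by (simp add: height_def)

lemma height_Cons [simp]: "height i (a # ks) = (if i < a then 1 else 0) + height i ks"
proof -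
  have "height i ks = length (filter (\<lambda>a. i + 1 \<le> a) ks)" for ks
    by (simp add: height_def length_filter_conv_card)
  then show ?thesis by simp
qed

text \<open>An entry splits as \<open>a = 1 + min r (a - 1) + (a - (r + 1))\<close>: its shares in
  the depth, the heights and the exponent of \<open>x_1\<close>. The additive form makes the
  truncated differences in \<open>heights_mset\<close> exact.\<close>

lemma sum_list_eq_count_index_mset:
  assumes "\<forall>a\<in>set ks. a \<ge> 1"
  shows "sum_list ks = length ks + (\<Sum>i=1..r. height i ks) + count (index_mset r ks) 1"
  using assms
proof (induction ks)
  case (Cons a ks)
  have "(\<Sum>i=1..r. if i < a then 1 else 0) = card {i\<in>{1..r}. i < a}"
    by (simp add: sum.If_cases Int_def)
  also have "{i\<in>{1..r}. i < a} = {1..min r (a - 1)}" by auto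
  finally have "a = 1 + (\<Sum>i=1..r. if i < a then 1 else 0) + count (entry_mset r a) 1"
    using Cons.prems by (auto simp: entry_mset_def)
  with Cons show ?case by (simp add: sum.distrib)
qed simp

lemma length_eq_count_index_mset:
  assumes "\<forall>a\<in>set ks. a \<ge> 1" "r \<ge> 1"
  shows "length ks = height 1 ks + count (index_mset r ks) 2"
  using assms by (induction ks) (auto simp: entry_mset_def min_def)

lemma height_eq_count_index_mset:
  assumes "1 \<le> i" "i < r"
  shows "height i ks = height (i + 1) ks + count (index_mset r ks) (i + 2)"
  using assms by (induction ks) (auto simp: entry_mset_def min_def)

lemma height_last_eq_count_index_mset:
  assumes "r \<ge> 1"
  shows "height r ks = count (index_mset r ks) (r + 2)"
  using assms by (induction ks) (auto simp: entry_mset_def min_def)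

lemma count_index_mset_eq_0:
  assumes "\<forall>a\<in>set ks. a \<ge> 1" "v = 0 \<or> v > r + 2"
  shows "count (index_mset r ks) v = 0"
  using assms by (induction ks) (auto simp: entry_mset_def min_def)

lemma count_heights_mset:
  assumes "r \<ge> 1"
  shows "count (heights_mset r k l h) v =
    (if v = 0 then 0 else if v = 1 then k - l - (\<Sum>i=1..r. h i) else if v = 2 then l - h 1
     else if v < r + 2 then h (v - 2) - h (v - 1) else if v = r + 2 then h r else 0)"
proof -
  have "(\<Sum>i\<in>{1..<r}. count (replicate_mset (h i - h (i + 1)) (i + 2)) v) =
      (\<Sum>i\<in>{1..<r} \<inter> {v - 2}. if v \<ge> 2 then h i - h (i + 1) else 0)"
    by (rule sum.mono_neutral_cong_right) auto
  also have "\<dots> = (if 2 < v \<and> v < r + 2 then h (v - 2) - h (v - 1) else 0)"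
    by (auto simp: Int_insert_right Suc_diff_Suc numeral_2_eq_2)
  finally have *: "(\<Sum>i\<in>{1..<r}. count (replicate_mset (h i - h (i + 1)) (i + 2)) v) =
    (if 2 < v \<and> v < r + 2 then h (v - 2) - h (v - 1) else 0)" .
  show ?thesis
    using assms unfolding heights_mset_def count_union count_sum * by auto
qed

lemma heights_mset_eq_index_mset:
  assumes "\<forall>a\<in>set ks. a \<ge> 1" "r \<ge> 1" "\<forall>i\<in>{1..r}. height i ks = h i"
  shows "heights_mset r (sum_list ks) (length ks) h = index_mset r ks"
proof (rule multiset_eqI)
  fix v
  have sum: "(\<Sum>i=1..r. h i) = (\<Sum>i=1..r. height i ks)"
    using assms(3) by (intro sum.cong) auto
  consider "v = 0 \<or> v > r + 2" | "v = 1" | "v = 2" | "v > 2" "v < r + 2" | "v = r + 2" by linarith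
  then show "count (heights_mset r (sum_list ks) (length ks) h) v = count (index_mset r ks) v"
  proof cases
    case 1
    then show ?thesis using count_index_mset_eq_0[OF assms(1)] assms(2)
      by (auto simp: count_heights_mset)
  next
    case 2
    then show ?thesis using sum_list_eq_count_index_mset[OF assms(1), of r] assms(2) sum
      by (simp add: count_heights_mset)
  next
    case 3
    then show ?thesis using length_eq_count_index_mset[OF assms(1,2)] assms(2,3)
      by (simp add: count_heights_mset)
  next
    case 4
    then have "height (v - 2) ks = height (v - 1) ks + count (index_mset r ks) v"
      using height_eq_count_index_mset[of "v - 2" r ks]
      by (simp add: Suc_diff_Suc numeral_2_eq_2)
    moreover have "height (v - 2) ks = h (v - 2)" "height (v - 1) ks = h (v - 1)"
      using 4 by (auto intro!: bspec[OF assms(3)])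
    ultimately show ?thesis using 4 assms(2) by (simp add: count_heights_mset)
  next
    case 5
    moreover have "height r ks = h r" using assms(2,3) by simp
    ultimately show ?thesis using height_last_eq_count_index_mset[OF assms(2), of ks] assms(2)
      by (simp add: count_heights_mset)
  qed
qed


section \<open>Generating functions as sums over indices\<close>

text \<open>Indices are collected by monomial rather than by weight, depth and heights;
  \<open>H\<close> will be a half-line or a single entry.\<close>

definition heads_set :: "nat \<Rightarrow> nat set \<Rightarrow> nat multiset \<Rightarrow> nat list set" where
  "heads_set r H \<mu> = {ks. ks \<noteq> [] \<and> (\<forall>a\<in>set ks. a \<ge> 1) \<and> hd ks \<in> H \<and> index_mset r ks = \<mu>}"

definition heads_sum :: "'a::field \<Rightarrow> 'a \<Rightarrow> nat \<Rightarrow> nat \<Rightarrow> nat set \<Rightarrow> 'a mvps" where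
  "heads_sum q t r n H = Abs_mvps (\<lambda>\<mu>. \<Sum>ks\<in>heads_set r H \<mu>. fps_nth (qLi_t q t ks) n)"

lemma size_entry_mset: "size (entry_mset r a) = Suc (a - (r + 1))"
  by (simp add: entry_mset_def)

text \<open>Each entry adds at least one letter and a large one adds many, so the size of the
  monomial bounds both length and entries.\<close>

lemma finite_heads_set [simp]: "finite (heads_set r H \<mu>)"
proof (rule finite_subset)
  have "length ks \<le> size (index_mset r ks) \<and> set ks \<subseteq> {..r + 1 + size (index_mset r ks)}" for ks
    by (induction ks) (auto simp: size_entry_mset)
  then show "heads_set r H \<mu> \<subseteq> {ks. set ks \<subseteq> {..r + 1 + size \<mu>} \<and> length ks \<le> size \<mu>}"
    by (auto simp: heads_set_def)
qed (rule finite_lists_length_le, simp)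

text \<open>No index has depth 0, so the exceptional value 1 can be added instead of replacing the
  sum.\<close>

lemma G_sum_eq:
  "G_sum q t r j k l h = (\<Sum>ks\<in>I_set r j k l h. qLi_t q t ks) +
    (if j = -1 \<and> k = 0 \<and> l = 0 \<and> (\<forall>i\<in>{1..r}. h i = 0) then 1 else 0)"
proof -
  have "I_set r j k 0 h = {}" by (auto simp: I_set_def)
  then show ?thesis by (auto simp: G_sum_def)
qed

lemma Phi_nth:
  fixes q :: "'a::field"
  assumes "r \<ge> 1"
  shows "fps_nth (Phi q t r j) n =
    to_fract (heads_sum q t r n {a. int a \<ge> j + 2} + (if j = -1 \<and> n = 0 then 1 else 0))"
proof -
  define c where "c ks = fps_nth (qLi_t q t ks) n" for ks
  define F where "F = (\<lambda>(k, l, h). mvps_const (fps_nth (G_sum q t r j k l h) n) * x_monom r k l h)"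
  define U :: "(nat \<times> nat \<times> (nat \<Rightarrow> nat)) set" where "U = UNIV \<times> UNIV \<times> ({1..r} \<rightarrow>\<^sub>E UNIV)"
  define profile where "profile ks = (sum_list ks, length ks, restrict (\<lambda>i. height i ks) {1..r})" for ks
  define z where "z = (0 :: nat, 0 :: nat, restrict (\<lambda>_. 0 :: nat) {1..r})"
  have "mvps_sum F U = heads_sum q t r n {a. int a \<ge> j + 2} + (if j = -1 \<and> n = 0 then 1 else 0)"
  proof (rule mvps_eqI)
    fix \<mu>
    define S where "S = heads_set r {a. int a \<ge> j + 2} \<mu>"
    \<comment> \<open>The share of the exceptional value 1, which sits at the zero profile
      \<open>z\<close>.\<close>
    define \<delta> :: 'a where "\<delta> = (if j = -1 \<and> n = 0 \<and> \<mu> = {#} then 1 else 0)"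
    have coeff_F: "mvps_coeff (F \<tau>) \<mu> = (\<Sum>ks | ks \<in> S \<and> profile ks = \<tau>. c ks) + (if \<tau> = z then \<delta> else 0)"
      if "\<tau> \<in> U" for \<tau>
    proof -
      obtain k l h where \<tau>: "\<tau> = (k, l, h)" by (cases \<tau>)
      have h: "h \<in> {1..r} \<rightarrow>\<^sub>E UNIV" using that by (simp add: \<tau> U_def)
      have z_iff: "\<tau> = z \<longleftrightarrow> k = 0 \<and> l = 0 \<and> (\<forall>i\<in>{1..r}. h i = 0)"
        using h by (auto simp: \<tau> z_def fun_eq_iff restrict_def PiE_def extensional_def)
      have profile_iff: "profile ks = \<tau> \<longleftrightarrow> sum_list ks = k \<and> length ks = l \<and> (\<forall>i\<in>{1..r}. height i ks = h i)" for ks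
        using h by (auto simp: \<tau> profile_def fun_eq_iff restrict_def PiE_def extensional_def)
      have index: "index_mset r ks = heights_mset r k l h"
        if "profile ks = \<tau>" "\<forall>a\<in>set ks. a \<ge> 1" for ks
        using heights_mset_eq_index_mset[of ks r h] that assms by (auto simp: profile_iff)
      have "heights_mset r k l h = {#}" if "\<tau> = z"
        using heights_mset_eq_index_mset[of "[]" r h] that assms unfolding z_iff by simp
      moreover have "(\<Sum>ks | ks \<in> S \<and> profile ks = \<tau>. c ks) =
          (if heights_mset r k l h = \<mu> then \<Sum>ks\<in>I_set r j k l h. c ks else 0)"
      proof (cases "heights_mset r k l h = \<mu>")
        case True
        then have "{ks. ks \<in> S \<and> profile ks = \<tau>} = I_set r j k l h"
          using index by (auto simp: S_def heads_set_def I_set_def profile_iff)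
        with True show ?thesis by simp
      next
        case False
        then have "{ks. ks \<in> S \<and> profile ks = \<tau>} = {}"
          using index by (auto simp: S_def heads_set_def)
        with False show ?thesis by (simp only: sum.empty if_False)
      qed
      moreover have "mvps_coeff (F \<tau>) \<mu> =
          (if heights_mset r k l h = \<mu> then fps_nth (G_sum q t r j k l h) n else 0)"
        by (simp add: F_def \<tau> x_monom_eq) (auto simp: mvps_monom_def)
      ultimately show ?thesis
        by (auto simp: G_sum_eq fps_sum_nth c_def \<delta>_def z_iff)
    qed
    have fin: "finite S" by (simp add: S_def)
    have "mvps_coeff (mvps_sum F U) \<mu> = (\<Sum>\<tau> | \<tau> \<in> U \<and> mvps_coeff (F \<tau>) \<mu> \<noteq> 0. mvps_coeff (F \<tau>) \<mu>)"
      by (simp add: mvps_sum_def)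
    \<comment> \<open>Only profiles of indices in the finite set \<open>S\<close>, and
      \<open>z\<close>, can contribute to the coefficient of \<mu>.\<close>
    also have "\<dots> = (\<Sum>\<tau>\<in>insert z (profile ` S). mvps_coeff (F \<tau>) \<mu>)"
    proof (rule sum.mono_neutral_left)
      have sub: "insert z (profile ` S) \<subseteq> U" by (auto simp: U_def z_def profile_def)
      show "\<forall>\<tau>\<in>insert z (profile ` S) - {\<tau> \<in> U. mvps_coeff (F \<tau>) \<mu> \<noteq> 0}. mvps_coeff (F \<tau>) \<mu> = 0"
        using sub by blast
      have "\<tau> \<in> insert z (profile ` S)" if "\<tau> \<in> U" "mvps_coeff (F \<tau>) \<mu> \<noteq> 0" for \<tau>
      proof (rule ccontr)
        assume *: "\<tau> \<notin> insert z (profile ` S)"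
        then have "{ks. ks \<in> S \<and> profile ks = \<tau>} = {}" by blast
        with * that show False by (simp add: coeff_F)
      qed
      then show "{\<tau> \<in> U. mvps_coeff (F \<tau>) \<mu> \<noteq> 0} \<subseteq> insert z (profile ` S)" by blast
    qed (use fin in simp)
    also have "\<dots> = (\<Sum>\<tau>\<in>insert z (profile ` S). (\<Sum>ks | ks \<in> S \<and> profile ks = \<tau>. c ks) + (if \<tau> = z then \<delta> else 0))"
      by (intro sum.cong coeff_F refl) (auto simp: U_def z_def profile_def)
    also have "\<dots> = (\<Sum>ks\<in>S. c ks) + \<delta>"
      using fin sum.group[of S "insert z (profile ` S)" profile c] by (simp add: sum.distrib subset_insertI)
    also have "\<dots> = mvps_coeff (heads_sum q t r n {a. int a \<ge> j + 2} + (if j = -1 \<and> n = 0 then 1 else 0)) \<mu>"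
      by (simp add: plus_mvps.rep_eq one_mvps.rep_eq zero_mvps.rep_eq heads_sum_def S_def c_def \<delta>_def)
    finally show "mvps_coeff (mvps_sum F U) \<mu> =
      mvps_coeff (heads_sum q t r n {a. int a \<ge> j + 2} + (if j = -1 \<and> n = 0 then 1 else 0)) \<mu>" .
  qed
  then show ?thesis by (simp only: Phi_def F_def U_def fps_nth_Abs_fps)
qed


section \<open>Relations between the generating functions\<close>

lemma heads_sum_nth_0 [simp]: "heads_sum q t r 0 H = 0"
  by (rule mvps_eqI) (simp add: heads_sum_def zero_mvps.rep_eq)

lemma heads_sum_Un:
  assumes "H \<inter> H' = {}"
  shows "heads_sum q t r n (H \<union> H') = heads_sum q t r n H + heads_sum q t r n H'"
proof (rule mvps_eqI)
  fix \<mu>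
  have "heads_set r (H \<union> H') \<mu> = heads_set r H \<mu> \<union> heads_set r H' \<mu>"
    "heads_set r H \<mu> \<inter> heads_set r H' \<mu> = {}"
    using assms by (auto simp: heads_set_def)
  then show "mvps_coeff (heads_sum q t r n (H \<union> H')) \<mu> =
      mvps_coeff (heads_sum q t r n H + heads_sum q t r n H') \<mu>"
    by (simp add: heads_sum_def plus_mvps.rep_eq sum.union_disjoint)
qed

text \<open>The coefficients of \<open>Li\<^sup>t\<close> are independent of the first entry \<open>a\<close> of the index up to the
  factor \<open>[n]\<^bsup>a\<^esup>\<close>; the series below corresponds to the otherwise inadmissible entry \<open>a = 0\<close>.\<close>

definition tails_sum :: "'a::field \<Rightarrow> 'a \<Rightarrow> nat \<Rightarrow> nat \<Rightarrow> 'a mvps" where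
  "tails_sum q t r n = Abs_mvps (\<lambda>\<mu>.
     \<Sum>ks | (\<forall>a\<in>set ks. a \<ge> 1) \<and> index_mset r ks = \<mu>. fps_nth (qLi_t q t (0 # ks)) n)"

text \<open>Prepending \<open>a\<close> to a tail multiplies its monomial by that of
  \<open>a\<close> and divides the coefficient by \<open>[n]^a\<close>.\<close>

lemma heads_sum_single:
  fixes q :: "'a::field"
  assumes "n > 0 \<Longrightarrow> qnum q n \<noteq> 0" "a \<ge> 1"
  shows "mvps_const (qnum q n ^ a) * heads_sum q t r n {a} =
    mvps_monom (entry_mset r a) * tails_sum q t r n"
proof (rule mvps_eqI)
  fix \<mu>
  have qLi: "qnum q n ^ a * fps_nth (qLi_t q t (a # ks)) n = fps_nth (qLi_t q t (0 # ks)) n" for ks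
    using qLi_t_add_hd[of n q a t 0, OF assms(1)] by simp
  show "mvps_coeff (mvps_const (qnum q n ^ a) * heads_sum q t r n {a}) \<mu> =
      mvps_coeff (mvps_monom (entry_mset r a) * tails_sum q t r n) \<mu>"
  proof (cases "entry_mset r a \<subseteq># \<mu>")
    case True
    then have "heads_set r {a} \<mu> =
        (#) a ` {ks. (\<forall>a\<in>set ks. a \<ge> 1) \<and> index_mset r ks = \<mu> - entry_mset r a}"
      using assms(2) by (force simp: heads_set_def neq_Nil_conv)
    with True show ?thesis
      by (simp add: heads_sum_def tails_sum_def mvps_coeff_monom_mult sum.reindex sum_distrib_left qLi)
  next
    case False
    then have "heads_set r {a} \<mu> = {}"
      by (auto simp: heads_set_def neq_Nil_conv)
    with False show ?thesis
      by (simp add: heads_sum_def mvps_coeff_monom_mult)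
  qed
qed

text \<open>Raising a first entry from \<open>r + 1\<close> on is a bijection onto the next
  half-line; it costs one \<open>x_1\<close> and divides the coefficient by
  \<open>[n]\<close>.\<close>

lemma heads_sum_shift:
  fixes q :: "'a::field"
  assumes "n > 0 \<Longrightarrow> qnum q n \<noteq> 0"
  shows "mvps_const (qnum q n) * heads_sum q t r n {r + 2..} =
    mvps_var 1 * heads_sum q t r n {r + 1..}"
proof (rule mvps_eqI)
  fix \<mu>
  have entry: "entry_mset r (Suc a) = add_mset 1 (entry_mset r a)" if "a \<ge> r + 1" for a
  proof -
    obtain b where "a = r + 1 + b" using \<open>a \<ge> r + 1\<close> le_Suc_ex by blast
    then show ?thesis by (simp add: entry_mset_def)
  qed
  define inc :: "nat list \<Rightarrow> nat list" where "inc ks = Suc (hd ks) # tl ks" for ks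
  have inj: "inj_on inc (heads_set r {r + 1..} \<nu>)" for \<nu>
    by (auto simp: inj_on_def inc_def heads_set_def list.expand)
  have qLi: "qnum q n * fps_nth (qLi_t q t (inc ks)) n = fps_nth (qLi_t q t ks) n" if "ks \<noteq> []" for ks
    using that qLi_t_add_hd[of n q 1 t "hd ks" "tl ks", OF assms] by (simp add: inc_def)
  have image: "inc ` heads_set r {r + 1..} \<nu> = heads_set r {r + 2..} (add_mset 1 \<nu>)" for \<nu>
  proof (intro equalityI subsetI)
    fix ks assume "ks \<in> heads_set r {r + 2..} (add_mset 1 \<nu>)"
    then obtain b ks' where b: "ks = b # ks'" "b \<ge> r + 2" "\<forall>a\<in>set ks'. a \<ge> 1"
      "index_mset r ks = add_mset 1 \<nu>"
      by (cases ks) (simp_all add: heads_set_def)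
    from b(2) obtain a where a: "b = Suc a" "a \<ge> r + 1" by (cases b) simp_all
    have "index_mset r (a # ks') = \<nu>" using b(4) a(2) by (simp add: b(1) a(1) entry)
    then have "a # ks' \<in> heads_set r {r + 1..} \<nu>" using a b(3) by (simp add: heads_set_def)
    then show "ks \<in> inc ` heads_set r {r + 1..} \<nu>"
      by (rule rev_image_eqI) (simp add: inc_def a b(1))
  next
    fix ks assume "ks \<in> inc ` heads_set r {r + 1..} \<nu>"
    then obtain ks' where ks: "ks = inc ks'" "ks' \<in> heads_set r {r + 1..} \<nu>" by blast
    then show "ks \<in> heads_set r {r + 2..} (add_mset 1 \<nu>)"
      by (cases ks') (simp_all add: heads_set_def inc_def entry)
  qed
  show "mvps_coeff (mvps_const (qnum q n) * heads_sum q t r n {r + 2..}) \<mu> =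
      mvps_coeff (mvps_var 1 * heads_sum q t r n {r + 1..}) \<mu>"
  proof (cases "1 \<in># \<mu>")
    case True
    then obtain \<nu> where \<mu>: "\<mu> = add_mset 1 \<nu>" by (metis mset_add)
    show ?thesis
      unfolding mvps_var_conv_monom mvps_coeff_monom_mult mvps_coeff_const_mult heads_sum_def mvps_coeff_Abs
        \<mu> image[symmetric] sum.reindex[OF inj] sum_distrib_left
      by (simp add: \<mu>) (intro sum.cong refl qLi, simp add: heads_set_def)
  next
    case False
    have "1 \<in># index_mset r ks" if "ks \<noteq> []" "hd ks \<ge> r + 2" for ks
      using that by (cases ks) (simp_all add: entry_mset_def)
    with False have "heads_set r {r + 2..} \<mu> = {}" by (auto simp: heads_set_def)
    with False show ?thesis
      by (simp add: heads_sum_def mvps_var_conv_monom mvps_coeff_monom_mult)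
  qed
qed

text \<open>The entries \<open>a\<close> and \<open>r + 1\<close> share the factor
  \<open>tails_sum\<close>. Eliminating it leaves the entry \<open>r + 1\<close>, which the shift
  relation expresses by the half-line.\<close>

lemma heads_sum_step:
  fixes q :: "'a::field"
  defines "X \<equiv> mvps_var :: nat \<Rightarrow> 'a mvps"
  assumes "n > 0" "qnum q n \<noteq> 0" "1 \<le> a" "a \<le> r"
  shows "X (r + 2) * heads_sum q t r n {a} =
    X (a + 1) * mvps_const (qnum q n) ^ (r - a) *
    ((mvps_const (qnum q n) - X 1) * heads_sum q t r n {r + 1..})"
proof -
  define N where "N = mvps_const (qnum q n)"
  have entry: "mvps_monom (entry_mset r b) = X (b + 1)" if "b \<le> r + 1" for b
    using that by (simp add: entry_mset_def X_def mvps_var_conv_monom)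
  have single: "N ^ b * heads_sum q t r n {b} = X (b + 1) * tails_sum q t r n"
    if "1 \<le> b" "b \<le> r + 1" for b
    using heads_sum_single[of n q b t r] that assms(3) by (simp add: N_def mvps_const_power entry)
  have "{r + 1..} = {r + 1} \<union> {r + 2..}" by auto
  then have "heads_sum q t r n {r + 1..} = heads_sum q t r n {r + 1} + heads_sum q t r n {r + 2..}"
    by (simp add: heads_sum_Un del: insert_is_Un[symmetric] Un_insert_left)
  then have last: "(N - X 1) * heads_sum q t r n {r + 1..} = N * heads_sum q t r n {r + 1}"
    using heads_sum_shift[of n q t r] assms(3) by (simp add: N_def X_def algebra_simps)
  have "N ^ a * (X (r + 2) * heads_sum q t r n {a}) = X (a + 1) * (X (r + 2) * tails_sum q t r n)"
    using single[of a] assms by (simp add: mult_ac)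
  also have "X (r + 2) * tails_sum q t r n = N ^ (r + 1) * heads_sum q t r n {r + 1}"
    using single[of "r + 1"] by simp
  also have "N ^ (r + 1) = N ^ a * N ^ (r - a) * N"
    using assms by (simp flip: power_add power_Suc2)
  also have "X (a + 1) * (N ^ a * N ^ (r - a) * N * heads_sum q t r n {r + 1}) =
      N ^ a * (X (a + 1) * N ^ (r - a) * ((N - X 1) * heads_sum q t r n {r + 1..}))"
    unfolding last by (simp only: mult_ac)
  \<comment> \<open>The factor \<open>N ^ a\<close> is nonzero and cancels, the power series forming
    an integral domain.\<close>
  finally show ?thesis
    using assms(3) by (simp add: N_def)
qed

text \<open>Each step of the induction on \<open>d\<close> adjoins the entry \<open>r - d\<close>.
  Its term \<open>x_(r+1-d) N^d (N - x_1)\<close> is the difference of the bracketed factors for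
  \<open>d + 1\<close> and \<open>d\<close>.\<close>

lemma heads_sum_relation:
  fixes q :: "'a::field"
  defines "X \<equiv> mvps_var :: nat \<Rightarrow> 'a mvps"
  assumes "n > 0 \<Longrightarrow> qnum q n \<noteq> 0" "d \<le> r"
  shows "X (r + 2) * heads_sum q t r n {r + 1 - d..} =
    ((\<Sum>m\<le>d. (X (r + 2 - m) - X 1 * X (r + 1 - m)) * mvps_const (qnum q n) ^ m) +
      X 1 * X (r + 1 - d) * mvps_const (qnum q n) ^ d) * heads_sum q t r n {r + 1..}"
proof (cases "n = 0")
  case False
  with assms have N0: "qnum q n \<noteq> 0" by simp
  define N where "N = mvps_const (qnum q n)"
  show ?thesis using \<open>d \<le> r\<close> unfolding N_def[symmetric]
  proof (induction d)
    case (Suc d)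
    have "{r + 1 - Suc d..} = {r - d} \<union> {r + 1 - d..}" using Suc.prems by auto
    then have "heads_sum q t r n {r + 1 - Suc d..} =
        heads_sum q t r n {r - d} + heads_sum q t r n {r + 1 - d..}"
      using Suc.prems by (simp add: heads_sum_Un del: insert_is_Un[symmetric] Un_insert_left)
    moreover have "X (r + 2) * heads_sum q t r n {r - d} =
        X (r + 1 - d) * N ^ d * ((N - X 1) * heads_sum q t r n {r + 1..})"
      using heads_sum_step[of n q "r - d" r t] False N0 Suc.prems by (simp add: N_def X_def Suc_diff_le)
    ultimately show ?case
      using Suc by (simp add: algebra_simps)
  qed (simp add: algebra_simps)
qed simp


section \<open>The system of \<open>q\<close>-difference equations\<close>

lemma to_fract_power: "to_fract (x ^ n) = to_fract x ^ n"
  by (induction n) simp_all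

text \<open>\<open>Dq\<close> acts over the fraction field with parameter \<open>scalar q\<close>,
  while the polylogarithms use \<open>q\<close> itself.\<close>

lemma qnum_scalar:
  fixes q :: "'a::field"
  assumes "q \<noteq> 1"
  shows "qnum (scalar q) n = scalar (qnum q n)"
proof -
  have "scalar (qnum q n) * (1 - scalar q) = 1 - scalar q ^ n"
    using assms by (simp add: qnum_def flip: to_fract_1 mvps_const_1 to_fract_diff to_fract_mult to_fract_power
        mvps_const_diff mvps_const_mult mvps_const_power)
  moreover have "1 - scalar q \<noteq> 0"
    using assms by (simp flip: to_fract_1 mvps_const_1 to_fract_diff mvps_const_diff)
  ultimately show ?thesis by (simp add: qnum_def nonzero_divide_eq_eq)
qed

text \<open>As \<open>Sq\<close> vanishes for \<open>m < i\<close>, the sums over \<open>m\<close>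
  and \<open>i\<close> can be interchanged; the inner sums are then powers of
  \<open>[n]\<close>.\<close>

lemma sum_A_coeff_qnum_ffact:
  fixes q :: "'a::field"
  assumes "d = nat (int r - 1 - j)" "-1 \<le> j" "j \<le> int r - 1"
  shows "(\<Sum>i\<le>d. A_coeff q r j i * qnum_ffact (scalar q) i n) =
    (\<Sum>m\<le>d. (x_var (r + 2 - m) - x_var 1 * x_var (r + 1 - m)) * qnum (scalar q) n ^ m) +
      x_var 1 * x_var (r + 1 - d) * qnum (scalar q) n ^ d"
proof -
  define B :: "nat \<Rightarrow> 'a mvps fract" where "B m = x_var (r + 2 - m) - x_var 1 * x_var (r + 1 - m)" for m
  define S where "S m = Sq (scalar q) m" for m
  define f where "f i = qnum_ffact (scalar q) i n" for i
  have j: "nat (j + 2) = r + 1 - d" using assms by auto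
  have "A_coeff q r j i = (\<Sum>m\<le>d. B m * S m i) + x_var 1 * x_var (r + 1 - d) * S d i" for i
  proof -
    have "(\<Sum>m=i..d. B m * S m i) = (\<Sum>m\<le>d. B m * S m i)"
      by (rule sum.mono_neutral_left) (auto simp: S_def Sq_eq_0)
    then show ?thesis by (simp add: A_coeff_def Let_def j B_def S_def assms(1))
  qed
  then have "(\<Sum>i\<le>d. A_coeff q r j i * f i) =
      (\<Sum>i\<le>d. \<Sum>m\<le>d. B m * (S m i * f i)) + x_var 1 * x_var (r + 1 - d) * (\<Sum>i\<le>d. S d i * f i)"
    by (simp add: distrib_right sum.distrib sum_distrib_right sum_distrib_left mult.assoc)
  also have "(\<Sum>i\<le>d. \<Sum>m\<le>d. B m * (S m i * f i)) = (\<Sum>m\<le>d. B m * (\<Sum>i\<le>d. S m i * f i))"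
    by (subst sum.swap) (simp add: sum_distrib_left)
  also have "\<dots> = (\<Sum>m\<le>d. B m * qnum (scalar q) n ^ m)"
  proof (intro sum.cong refl arg_cong[where f = "(*) _"])
    fix m assume "m \<in> {..d}"
    then have "(\<Sum>i\<le>d. S m i * f i) = (\<Sum>i\<le>m. S m i * f i)"
      by (intro sum.mono_neutral_right) (auto simp: S_def Sq_eq_0)
    then show "(\<Sum>i\<le>d. S m i * f i) = qnum (scalar q) n ^ m"
      by (simp add: S_def f_def sum_Sq_qnum_ffact)
  qed
  also have "(\<Sum>i\<le>d. S d i * f i) = qnum (scalar q) n ^ d"
    by (simp add: S_def f_def sum_Sq_qnum_ffact)
  finally show ?thesis by (simp add: B_def f_def)
qed

text \<open>The assumption on \<open>q\<close> makes \<open>[n]\<close> nonzero for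
  \<open>n > 0\<close>, as the relations between the coefficients of \<open>z^n\<close>
  require.\<close>

theorem Phi_eq_Dq_Phi:
  fixes q t :: "'a::field"
  assumes q: "\<And>n. n > 0 \<Longrightarrow> q ^ n \<noteq> 1"
    and "r \<ge> 1" and "-1 \<le> j" and "j \<le> int r - 1"
  shows "Phi q t r j =
    fps_const (1 / x_var (r + 2)) *
      (\<Sum>i=0..nat (int r - 1 - j).
         fps_const (A_coeff q r j i) * fps_X ^ i * (Dq (scalar q) ^^ i) (Phi q t r (int r - 1)))
    + (if j = -1 then 1 else 0)"
proof (rule fps_ext)
  fix n
  define d where "d = nat (int r - 1 - j)"
  define y where "y = Phi q t r (int r - 1)"
  define N where "N = qnum (scalar q) n"
  have "q \<noteq> 1" using q[of 1] by simp
  have N0: "qnum q n \<noteq> 0" if "n > 0"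
    using q[OF that] \<open>q \<noteq> 1\<close> by (simp add: qnum_def)
  have q1: "scalar q \<noteq> 1" using \<open>q \<noteq> 1\<close>
    by (metis mvps_const_1 mvps_const_diff mvps_const_eq_0_iff right_minus_eq to_fract_1 to_fract_eq_iff)
  have y: "fps_nth y n = to_fract (heads_sum q t r n {r + 1..})"
  proof -
    have "{a. int a \<ge> int r - 1 + 2} = {r + 1..}" by auto
    then show ?thesis using assms(2) by (simp add: y_def Phi_nth)
  qed
  have "d \<le> r" "{a. int a \<ge> j + 2} = {r + 1 - d..}" using assms by (auto simp: d_def)
  then have Phi_j: "fps_nth (Phi q t r j) n =
      to_fract (heads_sum q t r n {r + 1 - d..}) + (if j = -1 \<and> n = 0 then 1 else 0)"
    using assms(2) by (simp add: Phi_nth)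
  have "fps_nth (\<Sum>i\<le>d. fps_const (A_coeff q r j i) * fps_X ^ i * (Dq (scalar q) ^^ i) y) n =
      (\<Sum>i\<le>d. A_coeff q r j i * qnum_ffact (scalar q) i n) * fps_nth y n"
    using q1 by (simp add: fps_sum_nth mult.assoc X_power_Dq_funpow_nth sum_distrib_right)
  also have "\<dots> = ((\<Sum>m\<le>d. (x_var (r + 2 - m) - x_var 1 * x_var (r + 1 - m)) * N ^ m) +
      x_var 1 * x_var (r + 1 - d) * N ^ d) * fps_nth y n"
    using assms by (simp add: sum_A_coeff_qnum_ffact[OF d_def] N_def)
  also have "\<dots> = to_fract (mvps_var (r + 2) * heads_sum q t r n {r + 1 - d..})"
    using heads_sum_relation[of n q d r t] N0 \<open>d \<le> r\<close>
    by (simp add: y N_def qnum_scalar \<open>q \<noteq> 1\<close> to_fract_power)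
  finally show "fps_nth (Phi q t r j) n = fps_nth (fps_const (1 / x_var (r + 2)) *
      (\<Sum>i=0..nat (int r - 1 - j).
         fps_const (A_coeff q r j i) * fps_X ^ i * (Dq (scalar q) ^^ i) (Phi q t r (int r - 1)))
    + (if j = -1 then 1 else 0)) n"
    by (simp add: Phi_j flip: d_def y_def atMost_atLeast0)
qed

lemma q_par_power_neq_1:
  assumes "n > 0"
  shows "q_par ^ n \<noteq> 1"
proof
  assume "q_par ^ n = 1"
  then have "[:[:0, 1 :: rat:]:] ^ n = 1"
    by (simp add: q_par_def flip: to_fract_power to_fract_1)
  \<comment> \<open>Setting first \<open>t\<close> and then \<open>q\<close> to 0 turns the supposed
    equation into \<open>0 = 1\<close>.\<close>
  then have "poly ([:[:0, 1 :: rat:]:] ^ n) 0 = 1" by simp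
  then have "poly ([:0, 1 :: rat:] ^ n) 0 = poly 1 0" by simp
  then show False using assms by (simp add: power_0_left)
qed

theorem theorem3p8:
  fixes r :: nat and j :: int
  assumes "r \<ge> 1" and "-1 \<le> j" and "j \<le> int r - 1"
  shows "Phi q_par t_par r j =
    fps_const (1 / x_var (r + 2)) *
      (\<Sum>i=0..nat (int r - 1 - j).
         fps_const (A_coeff q_par r j i) * fps_X ^ i *
         (Dq (scalar q_par) ^^ i) (Phi q_par t_par r (int r - 1)))
    + (if j = -1 then 1 else 0)"
  using q_par_power_neq_1 assms by (rule Phi_eq_Dq_Phi)

end
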